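(* Let $X$ be a normed space and let $\mathcal{C},\mathcal{K}\subset X$ be (non-trivial) cones such that $\overline{\mathrm{co}}(\mathcal{C})\cap\mathcal{K}\neq\{0_X\}$. If $(\mathcal{C},\mathcal{K})$ has the strict separation property (SSP), then $\mathrm{int}(\mathcal{K})\neq\emptyset$ and there exist $\delta_2>\delta_1>0$ and $f\in X^*$ such that, for every $\alpha\in(\delta_1,\delta_2)$, $(f,\alpha)\in\mathcal{C}^{a\#}_+$ and $$f(x)+\alpha\|x\|<0<f(y)+\alpha\|y\|$$ for every $x\in-\overline{\mathrm{co}}(\mathcal{C})$, $x\neq0_X$, and every $y\in X\setminus\mathrm{int}(-\mathcal{K})$, $y\neq0_X$.
   Context: $X$ is a real normed space with origin $0_X$, dual $X^*$ and unit sphere $S_X=\{x\in X:\|x\|=1\}$. For $S\subset X$: $\overline S$ is the closure, $\mathrm{bd}(S)$ the boundary, $\mathrm{int}(S)$ the interior, $\mathrm{co}(S)$ the convex hull, $\overline{\mathrm{co}}(S)$ the closure of the convex hull, and $S_0:=S\cup\{0_X\}$. A cone is a set $\mathcal{C}\subset X$ with $\lambda x\in\mathcal{C}$ for all $\lambda\ge0$, $x\in\mathcal{C}$ (not necessarily convex or closed); all cones are assumed non-trivial: $\{0_X\}\subsetneq\mathcal{C}\subsetneq X$. For a cone $\mathcal{C}$, $\mathcal{C}_{\wedge}:=\mathrm{co}(\mathcal{C}\cap S_X)$ and $\mathcal{C}_{\vee}:=\mathrm{co}((\mathrm{bd}(\mathcal{C})\cap S_X)_0)$. The pair of cones $(\mathcal{C},\mathcal{K})$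 has the strict separation property (SSP) if $0_X\notin\overline{\mathcal{C}_{\wedge}-\mathcal{K}_{\vee}}$ (Minkowski difference). $\mathcal{C}^{\#}:=\{f\in X^*: f(x)>0\ \forall x\in\mathcal{C},\ x\neq0_X\}$ and $\mathcal{C}^{a\#}_+:=\{(f,\alpha)\in\mathcal{C}^{\#}\times(0,\infty): f(x)-\alpha\|x\|>0\ \forall x\in\mathcal{C},\ x\neq0_X\}$. *)

theory Defs
  imports "HOL-Analysis.Analysis"
begin

definition nontrivial_cone :: "'a::real_normed_vector set \<Rightarrow> bool" where
  "nontrivial_cone C \<longleftrightarrow> cone C \<and> {0} \<subset> C \<and> C \<subset> UNIV"

definition cone_wedge :: "'a::real_normed_vector set \<Rightarrow> 'a set" where
  "cone_wedge C = convex hull (C \<inter> sphere 0 1)"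

definition cone_vee :: "'a::real_normed_vector set \<Rightarrow> 'a set" where
  "cone_vee C = convex hull ((frontier C \<inter> sphere 0 1) \<union> {0})"

(* The infix minus on sets is the set-theoretic difference, hence a separate constant. *)
definition minkowski_diff :: "'a::real_normed_vector set \<Rightarrow> 'a set \<Rightarrow> 'a set" where
  "minkowski_diff A B = {a - b | a b. a \<in> A \<and> b \<in> B}"

definition strict_separation_property ::
    "'a::real_normed_vector set \<Rightarrow> 'a set \<Rightarrow> bool" where
  "strict_separation_property C K \<longleftrightarrow>
     0 \<notin> closure (minkowski_diff (cone_wedge C) (cone_vee K))"

definition dual_sharp :: "'a::real_normed_vector set \<Rightarrow> ('a \<Rightarrow>\<^sub>L real) set" where
  "dual_sharp C = {f. \<forall>x\<in>C. x \<noteq> 0 \<longrightarrow> blinfun_apply f x > 0}"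

definition aug_dual_sharp_plus ::
    "'a::real_normed_vector set \<Rightarrow> (('a \<Rightarrow>\<^sub>L real) \<times> real) set" where
  "aug_dual_sharp_plus C =
     {(f, \<alpha>) \<in> dual_sharp C \<times> {0<..}.
        \<forall>x\<in>C. x \<noteq> 0 \<longrightarrow> blinfun_apply f x - \<alpha> * norm x > 0}"

end

theory Submission
  imports Defs
begin

text \<open>
  Since \<^term>\<open>cone_wedge C\<close> and \<^term>\<open>cone_vee K\<close> are convex, SSP and Hahn-Banach give a
  functional \<open>f\<close> and \<open>d > 0\<close> with \<open>f a \<ge> f b + d\<close> for \<open>a\<close> in the former and \<open>b\<close> in the latter.
  Put \<open>s = sup f(b) \<ge> 0\<close> (the point 0 lies in \<^term>\<open>cone_vee K\<close>) and take
  \<open>s < \<alpha> < s + d\<close>. The closed convex cone \<open>f x \<ge> (s + d) \<parallel>x\<parallel>\<close> contains \<open>C\<close>, hence the closed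
  convex hull of \<open>C\<close>. The set \<open>P\<close> of nonzero \<open>x\<close> with \<open>f x \<ge> \<alpha> \<parallel>x\<parallel>\<close> is convex, misses the
  frontier of \<open>K\<close>, where \<open>f x \<le> s \<parallel>x\<parallel>\<close>, and meets \<open>K\<close> in a point of the closed convex hull of
  \<open>C\<close>; being connected, it lies in the interior of \<open>K\<close>.
\<close>

section \<open>Hahn-Banach separation by way of total vector orders\<close>

text \<open>Such a set consists of the strictly positive elements of a vector order: read
  \<open>y - x \<in> M\<close> as x < y. Excluding the origin is what makes the order
  irreflexive.\<close>

definition blunt_cone :: "'a::real_vector set \<Rightarrow> bool" where
  "blunt_cone M \<longleftrightarrow> 0 \<notin> M \<and> (\<forall>x\<in>M. \<forall>y\<in>M. x + y \<in> M) \<and> (\<forall>x\<in>M. \<forall>t>0. t *\<^sub>R x \<in> M)"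

text \<open>The cone generated by \<open>M\<close> and \<open>x\<close>, without the origin, works.
  A cancellation \<open>m + t *\<^sub>R x = 0\<close> with \<open>t > 0\<close> would, after
  division by \<open>t\<close>, put \<open>- x\<close> into \<open>M\<close> or force
  \<open>x = 0\<close>.\<close>

lemma blunt_cone_extend:
  assumes M: "blunt_cone M" and x: "x \<noteq> 0" "- x \<notin> M"
  shows "\<exists>N. blunt_cone N \<and> M \<subseteq> N \<and> x \<in> N"
proof -
  \<comment> \<open>With the origin adjoined, sums \<open>m + t *\<^sub>R x\<close> also cover
    \<open>M\<close> itself (\<open>t = 0\<close>) and \<open>x\<close>
    (\<open>m = 0\<close>).\<close>
  define M0 where "M0 = insert 0 M"
  have add0: "m + n \<in> M0" if "m \<in> M0" "n \<in> M0" for m n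
    using that M by (auto simp: M0_def blunt_cone_def)
  have sum0: "m = 0 \<and> n = 0" if "m \<in> M0" "n \<in> M0" "m + n = 0" for m n
    using that M unfolding M0_def blunt_cone_def by (metis add_0 add.right_neutral insert_iff)
  have scale0: "t *\<^sub>R m \<in> M0" if "m \<in> M0" "t > 0" for m t
    using that M by (auto simp: M0_def blunt_cone_def)
  have zero: "m = 0 \<and> t = 0" if m: "m \<in> M0" and t: "t \<ge> 0" and e: "m + t *\<^sub>R x = 0" for m t
  proof (cases "t = 0")
    case False
    then have "(1 / t) *\<^sub>R m \<in> M0"
      using m t scale0 by simp
    moreover have "m = - (t *\<^sub>R x)"
      using e by (simp add: eq_neg_iff_add_eq_0)
    ultimately show ?thesis
      using False x by (simp add: M0_def)
  qed (use e in simp)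
  define N where "N = {m + t *\<^sub>R x | m t. m \<in> M0 \<and> t \<ge> 0} - {0}"
  have "a + b \<in> N" if ab: "a \<in> N" "b \<in> N" for a b
  proof -
    obtain m t where a: "a = m + t *\<^sub>R x" "m \<in> M0" "t \<ge> 0" "a \<noteq> 0"
      using ab unfolding N_def by blast
    obtain n u where b: "b = n + u *\<^sub>R x" "n \<in> M0" "u \<ge> 0" "b \<noteq> 0"
      using ab unfolding N_def by blast
    have eq: "a + b = (m + n) + (t + u) *\<^sub>R x"
      by (simp add: a b algebra_simps)
    have "a + b \<noteq> 0"
    proof
      assume "a + b = 0"
      then have "m + n = 0 \<and> t + u = 0"
        using zero[of "m + n" "t + u"] add0 a b eq by simp
      then show False
        using sum0 a b by fastforce
    qed
    moreover have "m + n \<in> M0" "t + u \<ge> 0"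
      using a b add0 by auto
    ultimately show ?thesis
      unfolding N_def using eq by blast
  qed
  moreover have "u *\<^sub>R a \<in> N" if aN: "a \<in> N" and u: "u > 0" for a u
  proof -
    obtain m t where a: "a = m + t *\<^sub>R x" "m \<in> M0" "t \<ge> 0" "a \<noteq> 0"
      using aN unfolding N_def by blast
    have "u *\<^sub>R a = u *\<^sub>R m + (u * t) *\<^sub>R x"
      by (simp add: a algebra_simps)
    moreover have "u *\<^sub>R m \<in> M0" "u * t \<ge> 0" "u *\<^sub>R a \<noteq> 0"
      using a u scale0 by auto
    ultimately show ?thesis
      unfolding N_def by blast
  qed
  ultimately have "blunt_cone N"
    by (auto simp: blunt_cone_def N_def)
  moreover have "m \<in> N" if "m \<in> M" for m
  proof -
    have "m = m + 0 *\<^sub>R x" "m \<in> M0" "m \<noteq> 0"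
      using that M by (auto simp: M0_def blunt_cone_def)
    then show ?thesis
      unfolding N_def by blast
  qed
  moreover have "x \<in> N"
  proof -
    have "x = 0 + 1 *\<^sub>R x" "0 \<in> M0"
      by (auto simp: M0_def)
    then show ?thesis
      unfolding N_def using x(1) zero_le_one by blast
  qed
  ultimately show ?thesis
    by blast
qed

text \<open>Zorn's lemma gives a maximal blunt cone above \<open>P\<close>. If it missed both
  \<open>x\<close> and \<open>- x\<close>, adjoining \<open>x\<close> would enlarge it. The
  resulting order is total.\<close>

lemma blunt_cone_total_extension:
  assumes P: "blunt_cone P"
  obtains M where "blunt_cone M" "P \<subseteq> M" "\<And>x. x \<noteq> 0 \<Longrightarrow> x \<in> M \<or> - x \<in> M"
proof -
  define A where "A = {M. blunt_cone M \<and> P \<subseteq> M}"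
  have "\<exists>M\<in>A. \<forall>X\<in>A. M \<subseteq> X \<longrightarrow> X = M"
  proof (rule subset_Zorn_nonempty)
    show "A \<noteq> {}"
      using P A_def by auto
    fix \<C> assume ne: "\<C> \<noteq> {}" and ch: "subset.chain A \<C>"
    have blunt: "blunt_cone X" "P \<subseteq> X" if "X \<in> \<C>" for X
      using that ch by (auto simp: subset.chain_def A_def)
    have "x + y \<in> \<Union>\<C>" if xy: "x \<in> \<Union>\<C>" "y \<in> \<Union>\<C>" for x y
    proof -
      obtain X Y where XY: "X \<in> \<C>" "Y \<in> \<C>" "x \<in> X" "y \<in> Y"
        using xy by auto
      then have "X \<subseteq> Y \<or> Y \<subseteq> X"
        using ch by (auto simp: subset_chain_def)
      then obtain Z where "Z \<in> \<C>" "x \<in> Z" "y \<in> Z"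
        using XY by blast
      then show ?thesis
        using blunt(1)[of Z] by (auto simp: blunt_cone_def)
    qed
    moreover have "P \<subseteq> \<Union>\<C>"
      using ne blunt by blast
    ultimately show "\<Union>\<C> \<in> A"
      using blunt unfolding A_def blunt_cone_def by blast
  qed
  then obtain M where "M \<in> A" and max: "\<forall>X\<in>A. M \<subseteq> X \<longrightarrow> X = M"
    by (elim bexE)
  then have M: "blunt_cone M" "P \<subseteq> M"
    by (auto simp: A_def)
  have "x \<in> M \<or> - x \<in> M" if x: "x \<noteq> 0" for x
  proof (rule ccontr)
    assume "\<not> (x \<in> M \<or> - x \<in> M)"
    then obtain N where "blunt_cone N" "M \<subseteq> N" "x \<in> N" "x \<notin> M"
      using blunt_cone_extend[OF M(1) x] by blast
    then show False
      using max M by (auto simp: A_def)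
  qed
  with M that show thesis
    by blast
qed

text \<open>The functional is the Dedekind cut of \<open>x\<close> along \<open>e\<close> in the total order whose positive cone
  is \<open>M\<close>: \<open>f x = sup {t. t e < x}\<close>.\<close>

lemma blunt_cone_total_functional:
  fixes M :: "'a::real_normed_vector set"
  assumes M: "blunt_cone M" and total: "\<And>x. x \<noteq> 0 \<Longrightarrow> x \<in> M \<or> - x \<in> M"
    and ball: "ball e r \<subseteq> M" and r: "r > 0"
  obtains f where "bounded_linear f" "\<And>t x. x - t *\<^sub>R e \<in> M \<Longrightarrow> t \<le> f x"
proof -
  have M0: "0 \<notin> M" and add: "\<And>x y. x \<in> M \<Longrightarrow> y \<in> M \<Longrightarrow> x + y \<in> M"
    and scale: "\<And>x t. x \<in> M \<Longrightarrow> t > 0 \<Longrightarrow> t *\<^sub>R x \<in> M"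
    using M by (auto simp: blunt_cone_def)
  have eM: "e \<in> M"
    using ball r by auto
  \<comment> \<open>The ball around \<open>e\<close> makes \<open>e\<close> an order unit: every
    vector is dominated by a multiple of \<open>e\<close> controlled by its norm. Hence the cuts
    \<open>S x\<close> are nonempty and bounded above, and \<open>f\<close> has norm at most
    \<open>1 / r\<close>.\<close>
  have dominate: "t *\<^sub>R e + x \<in> M" if t: "norm x < t * r" for x t
  proof -
    have "t > 0"
      using t r by (smt (verit) norm_ge_zero zero_less_mult_pos2)
    then have "norm ((1 / t) *\<^sub>R x) < r"
      using t by (simp add: field_simps)
    then have "e + (1 / t) *\<^sub>R x \<in> M"
      using ball by (auto simp: dist_norm subset_iff)
    from scale[OF this \<open>t > 0\<close>] show ?thesis
      using \<open>t > 0\<close> by (simp add: algebra_simps)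
  qed
  define S where "S x = {t. x - t *\<^sub>R e \<in> M}" for x
  define f where "f x = Sup (S x)" for x
  have down: "u \<in> S x" if "t \<in> S x" "u \<le> t" for t u x
  proof (cases "u = t")
    case False
    then have "(t - u) *\<^sub>R e \<in> M"
      using scale eM that by simp
    then have "(x - t *\<^sub>R e) + (t - u) *\<^sub>R e \<in> M"
      using add that unfolding S_def by blast
    then show ?thesis
      by (simp add: S_def algebra_simps)
  qed (use that in simp)
  have low: "- t \<in> S x" if "norm x < t * r" for x t
    using dominate[OF that] by (simp add: S_def algebra_simps)
  have high: "u \<le> t" if "norm x < t * r" "u \<in> S x" for x t u
  proof (rule ccontr)
    assume "\<not> u \<le> t"
    then have "x - t *\<^sub>R e \<in> M"
      using down[OF that(2), of t] by (simp add: S_def)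
    moreover have "t *\<^sub>R e + - x \<in> M"
      using that by (intro dominate) simp
    ultimately show False
      using add M0 by fastforce
  qed
  have bound: "norm x < ((norm x + 1) / r) * r" for x :: 'a
    using r by simp
  have ne: "S x \<noteq> {}" for x
    using low[OF bound] by blast
  have bdd: "bdd_above (S x)" for x
    using high[OF bound] by (meson bdd_aboveI)
  have upper: "t \<le> f x" if "t \<in> S x" for t x
    unfolding f_def using that bdd by (rule cSup_upper)
  have less: "t \<in> S x" if "t < f x" for t x
    using that less_cSup_iff[OF ne bdd] down unfolding f_def by (meson less_imp_le)
  \<comment> \<open>Here totality enters. The case \<open>x = t *\<^sub>R e\<close> must be ruled
    out separately: then every \<open>u < t\<close> lies in the cut, which contradicts
    \<open>f x < t\<close>.\<close>
  have greater: "t *\<^sub>R e - x \<in> M" if "f x < t" for t x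
  proof -
    have "t \<notin> S x"
      using that upper by force
    moreover have "x - t *\<^sub>R e \<noteq> 0"
    proof
      assume "x - t *\<^sub>R e = 0"
      then have "x - u *\<^sub>R e = (t - u) *\<^sub>R e" for u
        by (simp add: algebra_simps)
      then have "u \<le> f x" if "u < t" for u
        using that eM scale upper by (simp add: S_def)
      then show False
        using \<open>f x < t\<close> dense by (meson leD)
    qed
    ultimately show ?thesis
      using total[of "x - t *\<^sub>R e"] by (auto simp: S_def)
  qed
  \<comment> \<open>A larger value at \<open>x + y\<close> would give an element of \<open>M\<close>
    that cancels against \<open>p *\<^sub>R e - x\<close> and \<open>q *\<^sub>R e - y\<close>, so
    that 0 would be in \<open>M\<close>. The strict slack in \<open>p\<close> and \<open>q\<close>
    is removed later by an epsilon argument.\<close>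
  have f_add_le: "f (x + y) \<le> p + q" if "f x < p" "f y < q" for x y p q
  proof (rule ccontr)
    assume "\<not> f (x + y) \<le> p + q"
    then have "(x + y) - (p + q) *\<^sub>R e \<in> M"
      using less[of "p + q" "x + y"] by (simp add: S_def)
    then have "((x + y) - (p + q) *\<^sub>R e) + ((p *\<^sub>R e - x) + (q *\<^sub>R e - y)) \<in> M"
      using that by (intro add greater)
    then show False
      using M0 by (simp add: algebra_simps)
  qed
  have f_add_ge: "p + q \<le> f (x + y)" if "p < f x" "q < f y" for x y p q
  proof -
    have "(x - p *\<^sub>R e) + (y - q *\<^sub>R e) \<in> M"
      using less[OF that(1)] less[OF that(2)] add by (simp add: S_def)
    then show ?thesis
      by (intro upper) (simp add: S_def algebra_simps)
  qed
  have f_add: "f (x + y) = f x + f y" for x y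
  proof (rule antisym)
    show "f (x + y) \<le> f x + f y"
    proof (rule field_le_epsilon)
      fix k :: real assume "k > 0"
      then show "f (x + y) \<le> f x + f y + k"
        using f_add_le[of x "f x + k / 2" y "f y + k / 2"] by simp
    qed
    show "f x + f y \<le> f (x + y)"
    proof (rule field_le_epsilon)
      fix k :: real assume "k > 0"
      then show "f x + f y \<le> f (x + y) + k"
        using f_add_ge[of "f x - k / 2" x "f y - k / 2" y] by simp
    qed
  qed
  have f_scale_le: "c * f x \<le> f (c *\<^sub>R x)" if c: "c > 0" for c x
  proof (rule field_le_epsilon)
    fix k :: real assume "k > 0"
    then have "x - (f x - k / c) *\<^sub>R e \<in> M"
      using less[of "f x - k / c" x] c by (simp add: S_def)
    from scale[OF this c] have "c * f x - k \<in> S (c *\<^sub>R x)"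
      using c by (simp add: S_def algebra_simps)
    then show "c * f x \<le> f (c *\<^sub>R x) + k"
      using upper by force
  qed
  \<comment> \<open>The reverse inequality is \<open>f_scale_le\<close> for the factor
    \<open>1 / c\<close> at the point \<open>c *\<^sub>R x\<close>.\<close>
  have f_scale_pos: "f (c *\<^sub>R x) = c * f x" if c: "c > 0" for c x
    using f_scale_le[OF c, of x] f_scale_le[of "1 / c" "c *\<^sub>R x"] c by (simp add: field_simps)
  have f_zero: "f 0 = 0"
    using f_add[of 0 0] by simp
  have f_minus: "f (- x) = - f x" for x
    using f_add[of x "- x"] f_zero by simp
  have f_scale: "f (c *\<^sub>R x) = c * f x" for c x
    using f_scale_pos[of c x] f_scale_pos[of "- c" x] f_zero f_minus[of "c *\<^sub>R x"]
    by (cases "c = 0"; cases "c > 0") auto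
  have f_le: "f x \<le> norm x * (1 / r)" for x
  proof (rule field_le_epsilon)
    fix k :: real assume "k > 0"
    then have "norm x < (norm x * (1 / r) + k) * r"
      using r by (simp add: algebra_simps)
    then show "f x \<le> norm x * (1 / r) + k"
      unfolding f_def using ne high by (intro cSup_least) auto
  qed
  have "\<bar>f x\<bar> \<le> norm x * (1 / r)" for x
    using f_le[of x] f_le[of "- x"] f_minus[of x] by simp
  then have "bounded_linear f"
    by (intro bounded_linear_intro[of f "1 / r"]) (auto simp: f_add f_scale)
  then show thesis
    using that upper by (auto simp: S_def)
qed

text \<open>Since \<open>D\<close> keeps a distance \<open>r\<close> from 0, the open
  \<open>r\<close>-neighbourhood of \<open>D\<close> generates a blunt cone. In a total extension of
  its order any \<open>e \<in> D\<close> is an order unit, and a point of \<open>D\<close> stays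
  positive after subtracting a small multiple \<open>d *\<^sub>R e\<close>, which bounds the
  functional below by \<open>d\<close>.\<close>

lemma convex_strict_separation_zero:
  fixes D :: "'a::real_normed_vector set"
  assumes D: "convex D" and 0: "0 \<notin> closure D"
  obtains f :: "'a \<Rightarrow>\<^sub>L real" and d where "d > 0" "\<And>x. x \<in> D \<Longrightarrow> d \<le> blinfun_apply f x"
proof (cases "D = {}")
  case True
  then show thesis
    using that[of 1] by auto
next
  case False
  then obtain e where e: "e \<in> D"
    by auto
  obtain r where r: "r > 0" and far: "\<And>x. x \<in> D \<Longrightarrow> r \<le> norm x"
    using 0 by (auto simp: closure_approachable not_less)
  define P where "P = {t *\<^sub>R (x + y) | t x y. t > 0 \<and> x \<in> D \<and> norm y < r}"
  have "blunt_cone P"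
    unfolding blunt_cone_def
  proof (intro conjI ballI allI impI)
    show "0 \<notin> P"
    proof
      assume "0 \<in> P"
      then obtain x y where "x \<in> D" "norm y < r" "x + y = 0"
        unfolding P_def by auto
      then show False
        using far[of x] by (metis add_eq_0_iff norm_minus_cancel not_less)
    qed
    fix a assume "a \<in> P"
    then obtain t x y where a: "a = t *\<^sub>R (x + y)" "t > 0" "x \<in> D" "norm y < r"
      unfolding P_def by auto
    show "u *\<^sub>R a \<in> P" if "u > 0" for u
    proof -
      have "u *\<^sub>R a = (u * t) *\<^sub>R (x + y)" "u * t > 0"
        using a that by auto
      then show ?thesis
        unfolding P_def using a by blast
    qed
    fix b assume "b \<in> P"
    then obtain u x' y' where b: "b = u *\<^sub>R (x' + y')" "u > 0" "x' \<in> D" "norm y' < r"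
      unfolding P_def by auto
    \<comment> \<open>The sum of two scaled points is \<open>t + u\<close> times a convex
      combination, so convexity of \<open>D\<close> and of the ball gives closure under
      addition.\<close>
    have tu: "t + u > 0" "t / (t + u) \<ge> 0" "u / (t + u) \<ge> 0" "t / (t + u) + u / (t + u) = 1"
      using a(2) b(2) by (auto simp flip: add_divide_distrib)
    define z where "z = (t / (t + u)) *\<^sub>R x + (u / (t + u)) *\<^sub>R x'"
    define w where "w = (t / (t + u)) *\<^sub>R y + (u / (t + u)) *\<^sub>R y'"
    have "z \<in> D"
      unfolding z_def using D a b tu by (intro convexD) auto
    moreover have "w \<in> ball 0 r"
      unfolding w_def using a b tu by (intro convexD) auto
    moreover have "a + b = (t + u) *\<^sub>R (z + w)"
      using tu(1) by (simp add: a b z_def w_def scaleR_add_right add_ac)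
    ultimately show "a + b \<in> P"
      unfolding P_def using tu(1) by auto
  qed
  then obtain M where M: "blunt_cone M" "P \<subseteq> M" "\<And>x. x \<noteq> 0 \<Longrightarrow> x \<in> M \<or> - x \<in> M"
    by (rule blunt_cone_total_extension) blast
  have near: "x + y \<in> M" if "x \<in> D" "norm y < r" for x y
  proof -
    have "x + y = 1 *\<^sub>R (x + y)"
      by simp
    then have "x + y \<in> P"
      unfolding P_def using that zero_less_one by blast
    then show ?thesis
      using M by blast
  qed
  have "ball e r \<subseteq> M"
  proof
    fix x assume "x \<in> ball e r"
    then show "x \<in> M"
      using near[OF e, of "x - e"] by (simp add: dist_norm norm_minus_commute)
  qed
  then obtain f where f: "bounded_linear f" "\<And>t x. x - t *\<^sub>R e \<in> M \<Longrightarrow> t \<le> f x"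
    using blunt_cone_total_functional[OF M(1,3) _ r] by blast
  \<comment> \<open>This makes the norm of \<open>d *\<^sub>R e\<close> equal to
    \<open>r / 2\<close>, inside the allowed perturbation.\<close>
  define d where "d = r / (2 * norm e)"
  have "norm e > 0"
    using far[OF e] r by linarith
  then have d: "d > 0" "norm (d *\<^sub>R e) < r"
    using r by (auto simp: d_def)
  have "d \<le> f x" if "x \<in> D" for x
    using f(2) near[OF that, of "- (d *\<^sub>R e)"] d by simp
  with d f(1) that[of d "Blinfun f"] show thesis
    by (simp add: bounded_linear_Blinfun_apply)
qed

section \<open>Bishop-Phelps cones and frontiers of cones\<close>

text \<open>A connected set that meets \<open>T\<close> cannot leave it without crossing the
  frontier, and the closure minus the frontier is the interior.\<close>

lemma connected_subset_interior:
  assumes "connected S" "S \<inter> T \<noteq> {}" "S \<inter> frontier T = {}"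
  shows "S \<subseteq> interior T"
proof -
  have "S \<subseteq> closure T"
    using connected_Int_frontier[OF assms(1,2)] assms(3) closure_subset by blast
  then show ?thesis
    using assms(3) unfolding frontier_def by blast
qed

text \<open>The norm is convex and \<open>f\<close> is linear; \<open>\<alpha> \<ge> 0\<close>
  preserves the triangle inequality.\<close>

lemma convex_bishop_phelps_cone:
  fixes f :: "'a::real_normed_vector \<Rightarrow>\<^sub>L real"
  assumes "\<alpha> \<ge> 0"
  shows "convex {x. \<alpha> * norm x \<le> blinfun_apply f x}"
  unfolding convex_alt
proof clarsimp
  fix x y u assume a: "\<alpha> * norm x \<le> blinfun_apply f x" "\<alpha> * norm y \<le> blinfun_apply f y"
    "0 \<le> (u::real)" "u \<le> 1"
  have "norm ((1 - u) *\<^sub>R x + u *\<^sub>R y) \<le> (1 - u) * norm x + u * norm y"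
    using norm_triangle_ineq[of "(1 - u) *\<^sub>R x" "u *\<^sub>R y"] a by simp
  then have "\<alpha> * norm ((1 - u) *\<^sub>R x + u *\<^sub>R y) \<le> \<alpha> * ((1 - u) * norm x + u * norm y)"
    using assms by (rule mult_left_mono)
  also have "\<dots> = (1 - u) * (\<alpha> * norm x) + u * (\<alpha> * norm y)"
    by (simp add: algebra_simps)
  also have "\<dots> \<le> (1 - u) * blinfun_apply f x + u * blinfun_apply f y"
    using a by (intro add_mono mult_left_mono) auto
  finally show "\<alpha> * norm ((1 - u) *\<^sub>R x + u *\<^sub>R y)
      \<le> blinfun_apply f ((1 - u) *\<^sub>R x + u *\<^sub>R y)"
    by (simp add: blinfun.add_right blinfun.scaleR_right)
qed

text \<open>Deleting the apex keeps convexity because the remaining points are exactly those of the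
  cone in the open half-space \<open>f > 0\<close>. The apex has to go since it may lie on the
  frontier of \<open>K\<close>.\<close>

lemma convex_bishop_phelps_cone_nonzero:
  fixes f :: "'a::real_normed_vector \<Rightarrow>\<^sub>L real"
  assumes "\<alpha> > 0"
  shows "convex ({x. \<alpha> * norm x \<le> blinfun_apply f x} - {0})"
proof -
  have pos: "blinfun_apply f x > 0" if "\<alpha> * norm x \<le> blinfun_apply f x" "x \<noteq> 0" for x
    using that assms by (smt (verit) mult_pos_pos zero_less_norm_iff)
  have "{x. \<alpha> * norm x \<le> blinfun_apply f x} - {0}
      = {x. \<alpha> * norm x \<le> blinfun_apply f x} \<inter> blinfun_apply f -` {0<..}"
    using pos by auto
  moreover have "convex (blinfun_apply f -` {0<..})"
    by (intro convex_linear_vimage bounded_linear.linear blinfun.bounded_linear_right) auto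
  ultimately show ?thesis
    using convex_bishop_phelps_cone[of \<alpha> f] assms by (simp add: convex_Int)
qed

lemma cone_normalize_Int_sphere:
  fixes C :: "'a::real_normed_vector set"
  assumes "cone C" "x \<in> C" "x \<noteq> 0"
  shows "(1 / norm x) *\<^sub>R x \<in> C \<inter> sphere 0 1"
  using assms unfolding cone_def by simp

lemma interior_scaleR:
  fixes S :: "'a::real_normed_vector set"
  assumes "c \<noteq> 0"
  shows "interior ((*\<^sub>R) c ` S) = (*\<^sub>R) c ` interior S"
proof
  have super: "(*\<^sub>R) a ` interior T \<subseteq> interior ((*\<^sub>R) a ` T)" if "a \<noteq> 0" for a and T :: "'a set"
    using that by (intro interior_maximal image_mono interior_subset open_scaling open_interior)
  then show "(*\<^sub>R) c ` interior S \<subseteq> interior ((*\<^sub>R) c ` S)"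
    using assms .
  show "interior ((*\<^sub>R) c ` S) \<subseteq> (*\<^sub>R) c ` interior S"
  proof
    fix x assume "x \<in> interior ((*\<^sub>R) c ` S)"
    then have "(1 / c) *\<^sub>R x \<in> interior ((*\<^sub>R) (1 / c) ` (*\<^sub>R) c ` S)"
      using super[of "1 / c" "(*\<^sub>R) c ` S"] assms by auto
    then have "(1 / c) *\<^sub>R x \<in> interior S"
      using assms by (simp add: image_image)
    moreover have "x = c *\<^sub>R ((1 / c) *\<^sub>R x)"
      using assms by simp
    ultimately show "x \<in> (*\<^sub>R) c ` interior S"
      by blast
  qed
qed

text \<open>Scaling by \<open>t > 0\<close> is a homeomorphism that maps \<open>K\<close> onto
  itself. This allows frontier points to be normalized to the unit sphere, where
  \<open>cone_vee K\<close> sees them.\<close>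

lemma frontier_cone_scale:
  fixes K :: "'a::real_normed_vector set"
  assumes K: "cone K" and x: "x \<in> frontier K" and t: "t > 0"
  shows "t *\<^sub>R x \<in> frontier K"
proof -
  have "(*\<^sub>R) t ` K = K"
  proof
    show "(*\<^sub>R) t ` K \<subseteq> K"
      using K t by (auto simp: cone_def)
    show "K \<subseteq> (*\<^sub>R) t ` K"
    proof
      fix y assume "y \<in> K"
      then have "(1 / t) *\<^sub>R y \<in> K" "y = t *\<^sub>R ((1 / t) *\<^sub>R y)"
        using K t by (auto simp: cone_def)
      then show "y \<in> (*\<^sub>R) t ` K"
        by blast
    qed
  qed
  moreover have "closure ((*\<^sub>R) t ` K) = (*\<^sub>R) t ` closure K"
    by (rule closure_scaleR[symmetric])
  moreover have "interior ((*\<^sub>R) t ` K) = (*\<^sub>R) t ` interior K"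
    using interior_scaleR[of t K] t by simp
  moreover have "inj ((*\<^sub>R) t :: 'a \<Rightarrow> 'a)"
    using t by (auto simp: inj_on_def)
  ultimately have "frontier K = (*\<^sub>R) t ` frontier K"
    by (metis frontier_def image_set_diff)
  then show ?thesis
    using x by blast
qed

section \<open>Separation of the two cones by a functional plus a multiple of the norm\<close>

theorem theorem3p3:
  fixes C K :: "'a::real_normed_vector set"
  assumes "nontrivial_cone C" and "nontrivial_cone K"
    and "closure (convex hull C) \<inter> K \<noteq> {0}"
    and "strict_separation_property C K"
  shows "interior K \<noteq> {} \<and>
    (\<exists>\<delta>1 \<delta>2 :: real. \<exists>f :: 'a \<Rightarrow>\<^sub>L real. 0 < \<delta>1 \<and> \<delta>1 < \<delta>2 \<and>
      (\<forall>\<alpha>\<in>{\<delta>1<..<\<delta>2}.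
        (f, \<alpha>) \<in> aug_dual_sharp_plus C \<and>
        (\<forall>x \<in> uminus ` closure (convex hull C). x \<noteq> 0 \<longrightarrow> blinfun_apply f x + \<alpha> * norm x < 0) \<and>
        (\<forall>y \<in> UNIV - interior (uminus ` K). y \<noteq> 0 \<longrightarrow> 0 < blinfun_apply f y + \<alpha> * norm y)))"
proof -
  have coneC: "cone C" and C0: "0 \<in> C" and coneK: "cone K" and K0: "0 \<in> K"
    using assms by (auto simp: nontrivial_cone_def)
  obtain c where c: "c \<in> C" "c \<noteq> 0"
    using assms(1) by (auto simp: nontrivial_cone_def)
  have "minkowski_diff (cone_wedge C) (cone_vee K)
      = (\<Union>x\<in>cone_wedge C. \<Union>y\<in>cone_vee K. {x - y})"
    by (auto simp: minkowski_diff_def)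
  then have "convex (minkowski_diff (cone_wedge C) (cone_vee K))"
    by (simp add: convex_differences cone_wedge_def cone_vee_def)
  then obtain f :: "'a \<Rightarrow>\<^sub>L real" and d where d: "d > 0"
    and fd: "\<And>x. x \<in> minkowski_diff (cone_wedge C) (cone_vee K) \<Longrightarrow> d \<le> blinfun_apply f x"
    using convex_strict_separation_zero assms(4) unfolding strict_separation_property_def by metis
  have sep: "blinfun_apply f b + d \<le> blinfun_apply f a"
    if "a \<in> cone_wedge C" "b \<in> cone_vee K" for a b
    using fd[of "a - b"] that by (force simp: minkowski_diff_def blinfun.diff_right)
  define B where "B = blinfun_apply f ` cone_vee K"
  define s where "s = Sup B"
  have wedge: "(1 / norm x) *\<^sub>R x \<in> cone_wedge C" if "x \<in> C" "x \<noteq> 0" for x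
    using cone_normalize_Int_sphere[OF coneC that] unfolding cone_wedge_def
    by (rule hull_inc)
  have vee0: "0 \<in> cone_vee K"
    by (simp add: cone_vee_def hull_inc)
  \<comment> \<open>One normalized nonzero point of \<open>C\<close> bounds \<open>f\<close> from
    above on all of \<open>cone_vee K\<close>.\<close>
  have bdd: "bdd_above B"
    using sep[OF wedge[OF c]] unfolding B_def by (intro bdd_aboveI2) (simp add: le_diff_eq[symmetric])
  have le_s: "blinfun_apply f b \<le> s" if "b \<in> cone_vee K" for b
    unfolding s_def using that bdd by (intro cSup_upper) (auto simp: B_def)
  have s0: "s \<ge> 0"
    using le_s[OF vee0] by simp
  have ge: "s + d \<le> blinfun_apply f a" if "a \<in> cone_wedge C" for a
  proof -
    have "s \<le> blinfun_apply f a - d"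
      unfolding s_def using vee0 sep[OF that]
      by (intro cSup_least) (auto simp: B_def le_diff_eq)
    then show ?thesis
      by simp
  qed
  have C_sub: "C \<subseteq> {x. (s + d) * norm x \<le> blinfun_apply f x}"
  proof clarify
    fix x assume "x \<in> C"
    then show "(s + d) * norm x \<le> blinfun_apply f x"
      using ge[OF wedge, of x] by (cases "x = 0") (auto simp: blinfun.scaleR_right field_simps)
  qed
  have "closed {x. (s + d) * norm x \<le> blinfun_apply f x}"
    by (intro closed_Collect_le continuous_intros)
  then have hull: "closure (convex hull C) \<subseteq> {x. (s + d) * norm x \<le> blinfun_apply f x}"
    using C_sub s0 d by (intro closure_minimal hull_minimal convex_bishop_phelps_cone) auto
  have hull_gt: "\<alpha> * norm x < blinfun_apply f x"
    if "x \<in> closure (convex hull C)" "x \<noteq> 0" "\<alpha> < s + d" for x \<alpha>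
  proof -
    have "\<alpha> * norm x < (s + d) * norm x"
      using that by simp
    also have "\<dots> \<le> blinfun_apply f x"
      using hull that by blast
    finally show ?thesis .
  qed
  \<comment> \<open>By homogeneity the bound \<open>s\<close> on unit frontier vectors extends to
    the whole frontier.\<close>
  have frontier_le: "blinfun_apply f x \<le> s * norm x" if "x \<in> frontier K" for x
  proof (cases "x = 0")
    case False
    then have "(1 / norm x) *\<^sub>R x \<in> frontier K \<inter> sphere 0 1"
      using frontier_cone_scale[OF coneK that, of "1 / norm x"] by simp
    then have "(1 / norm x) *\<^sub>R x \<in> cone_vee K"
      unfolding cone_vee_def by (intro hull_inc) blast
    from le_s[OF this] show ?thesis
      using False by (simp add: blinfun.scaleR_right field_simps)
  qed simp
  have C_hull: "C \<subseteq> closure (convex hull C)"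
    using hull_subset closure_subset by (rule subset_trans)
  \<comment> \<open>Both sets contain 0, so an intersection different from \<open>{0}\<close> has a
    nonzero point.\<close>
  then obtain k where k: "k \<in> closure (convex hull C)" "k \<in> K" "k \<noteq> 0"
    using assms(3) C0 K0 by blast
  have interior: "x \<in> interior K"
    if \<alpha>: "s < \<alpha>" "\<alpha> < s + d" and x: "\<alpha> * norm x \<le> blinfun_apply f x" "x \<noteq> 0" for \<alpha> x
  proof -
    let ?P = "{x. \<alpha> * norm x \<le> blinfun_apply f x} - {0}"
    have "k \<in> ?P \<inter> K"
      using k hull_gt[OF k(1,3) \<alpha>(2)] by simp
    moreover have "?P \<inter> frontier K = {}"
    proof -
      have "blinfun_apply f y < \<alpha> * norm y" if "y \<in> frontier K" "y \<noteq> 0" for y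
      proof -
        have "s * norm y < \<alpha> * norm y"
          using \<alpha> that by simp
        then show ?thesis
          using frontier_le[OF that(1)] by simp
      qed
      then show ?thesis
        by force
    qed
    moreover have "connected ?P"
      using \<alpha> s0 by (intro convex_connected convex_bishop_phelps_cone_nonzero) simp
    ultimately have "?P \<subseteq> interior K"
      using connected_subset_interior[of ?P K] by blast
    then show ?thesis
      using x by blast
  qed
  \<comment> \<open>The value \<open>s + d / 2\<close> is just one admissible
    \<open>\<alpha>\<close> strictly between \<open>s\<close> and \<open>s + d\<close>.\<close>
  have "k \<in> interior K"
    using interior[of "s + d / 2" k] hull_gt[OF k(1,3), of "s + d / 2"] k d by simp
  moreover have "(f, \<alpha>) \<in> aug_dual_sharp_plus C \<and>
        (\<forall>x \<in> uminus ` closure (convex hull C). x \<noteq> 0 \<longrightarrow> blinfun_apply f x + \<alpha> * norm x < 0) \<and>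
        (\<forall>y \<in> UNIV - interior (uminus ` K). y \<noteq> 0 \<longrightarrow> 0 < blinfun_apply f y + \<alpha> * norm y)"
    \<comment> \<open>The left end is moved up from \<open>s\<close>, which may be 0, because it
      must be positive.\<close>
    if "\<alpha> \<in> {s + d / 3<..<s + d}" for \<alpha>
  proof (intro conjI ballI impI)
    have \<alpha>: "s < \<alpha>" "\<alpha> < s + d" "\<alpha> > 0"
      using that d s0 by auto
    have gt: "\<alpha> * norm x < blinfun_apply f x" if "x \<in> C" "x \<noteq> 0" for x
      using hull_gt[OF _ _ \<alpha>(2)] that C_hull by blast
    have "blinfun_apply f x > 0" if "x \<in> C" "x \<noteq> 0" for x
      using gt[OF that] \<alpha>(3) by (smt (verit) mult_nonneg_nonneg norm_ge_zero)
    with gt show "(f, \<alpha>) \<in> aug_dual_sharp_plus C"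
      using \<alpha> by (auto simp: aug_dual_sharp_plus_def dual_sharp_def)
    show "blinfun_apply f x + \<alpha> * norm x < 0"
      if "x \<in> uminus ` closure (convex hull C)" "x \<noteq> 0" for x
      using that hull_gt[OF _ _ \<alpha>(2)] by (auto simp: blinfun.minus_right)
    show "0 < blinfun_apply f y + \<alpha> * norm y"
      if "y \<in> UNIV - interior (uminus ` K)" "y \<noteq> 0" for y
    proof (rule ccontr)
      assume "\<not> 0 < blinfun_apply f y + \<alpha> * norm y"
      \<comment> \<open>The negated inequality says that \<open>- y\<close> satisfies
        \<open>\<alpha> * norm (- y) \<le> f (- y)\<close>, so it falls under the fact
        \<open>interior\<close>; reflection then gives \<open>y\<close> in the interior of the
        negative of \<open>K\<close>.\<close>
      then have "- y \<in> interior K"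
        using that by (intro interior[OF \<alpha>(1,2)]) (auto simp: blinfun.minus_right)
      then have "y \<in> interior (uminus ` K)"
        using interior_scaleR[of "- 1" K] by (auto simp: image_iff intro: bexI[of _ "- y"])
      then show False
        using that by simp
    qed
  qed
  moreover have "0 < s + d / 3" "s + d / 3 < s + d"
    using s0 d by auto
  ultimately show ?thesis
    by blast
qed

end
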